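(* For $(M^0,M^1)\in\mathcal M(\theta_0,\theta_1,\theta_\infty)$ let $x_0=m^0_{11}$, $x_1=m^1_{11}$, $x_2=\mathrm{tr}(M^1M^0)$, let $M^j_{(1)}=M^1M^0\,M^j\,(M^1M^0)^{-1}=(m^j_{(1),kl})$ for $j=0,1$, and write $x_0^{(1)}=m^0_{(1),11}$, $x_1^{(1)}=m^1_{(1),11}$, $x_2^{(1)}=\mathrm{tr}(M^1_{(1)}M^0_{(1)})$. Then $(x_0^{(1)},x_1^{(1)},x_2^{(1)})\in\mathbf V_{(\theta_0,\theta_1,\theta_\infty)}$, and $$x_0^{(1)}=-x_1x_2-x_0+\mathrm{tr}M^0+e^{-\pi i\theta_\infty}\mathrm{tr}M^1,$$ $$x_1^{(1)}=x_1x_2^2+x_0x_2-x_1-(\mathrm{tr}M^0+e^{-\pi i\theta_\infty}\mathrm{tr}M^1)x_2+\mathrm{tr}M^1+e^{-\pi i\theta_\infty}\mathrm{tr}M^0,$$ $$x_2^{(1)}=x_2.$$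
   Context: $\theta_0,\theta_1,\theta_\infty\in\mathbb{C}$; $\sigma_3=\mathrm{diag}(1,-1)$. $\mathcal M(\theta_0,\theta_1,\theta_\infty)$ is the set of pairs $(M^0,M^1)\in SL_2(\mathbb{C})^2$, $M^0=(m^0_{kl})$, $M^1=(m^1_{kl})$, satisfying $m^0_{11}m^1_{11}+m^0_{21}m^1_{12}=e^{-\pi i\theta_\infty}$, $\mathrm{tr}M^0=2\cos\pi\theta_0$, $\mathrm{tr}M^1=2\cos\pi\theta_1$, modulo $(M^0,M^1)\sim c^{\sigma_3}(M^0,M^1)c^{-\sigma_3}$, $c\in\mathbb{C}\setminus\{0\}$. The character variety is $$\mathbf V_{(\theta_0,\theta_1,\theta_\infty)}:\ x_0x_1x_2+x_0^2+x_1^2-\mu_0x_0-\mu_1x_1-e^{-\pi i\theta_\infty}x_2+\kappa=0,$$ where, with $T_0=2\cos\pi\theta_0$ $(=\mathrm{tr}M^0)$, $T_1=2\cos\pi\theta_1$ $(=\mathrm{tr}M^1)$, $\mu_0=T_0+e^{-\pi i\theta_\infty}T_1$, $\mu_1=T_1+e^{-\pi i\theta_\infty}T_0$, $\kappa=e^{-2\pi i\theta_\infty}+e^{-\pi i\theta_\infty}T_0T_1+1$. *)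

theory Defs
  imports "HOL-Analysis.Analysis"
begin

type_synonym mat2 = "complex ^ 2 ^ 2"

definition SL2 :: "mat2 set" where
  "SL2 = {A. det A = 1}"

text \<open>\<open>e_inf \<theta>inf\<close> is $e^{-\pi i\theta_\infty}$, and \<open>tr_of \<theta>\<close> is the
  prescribed trace $2\cos\pi\theta$.\<close>

definition e_inf :: "complex \<Rightarrow> complex" where
  "e_inf \<theta>inf = exp (- (of_real pi * \<i> * \<theta>inf))"

definition tr_of :: "complex \<Rightarrow> complex" where
  "tr_of \<theta> = 2 * cos (of_real pi * \<theta>)"

text \<open>\<open>sigma3_pow c k\<close> is $c^{k\sigma_3} = \mathrm{diag}(c^k, c^{-k})$.\<close>

definition sigma3_pow :: "complex \<Rightarrow> int \<Rightarrow> mat2" where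
  "sigma3_pow c k = vector [vector [c powi k, 0], vector [0, c powi (- k)]]"

definition monodromy_pairs :: "complex \<Rightarrow> complex \<Rightarrow> complex \<Rightarrow> (mat2 \<times> mat2) set" where
  "monodromy_pairs \<theta>0 \<theta>1 \<theta>inf = {(M0, M1).
     M0 \<in> SL2 \<and> M1 \<in> SL2 \<and>
     M0$1$1 * M1$1$1 + M0$2$1 * M1$1$2 = e_inf \<theta>inf \<and>
     trace M0 = tr_of \<theta>0 \<and> trace M1 = tr_of \<theta>1}"

definition monodromy_rel ::
    "complex \<Rightarrow> complex \<Rightarrow> complex \<Rightarrow> ((mat2 \<times> mat2) \<times> (mat2 \<times> mat2)) set" where
  "monodromy_rel \<theta>0 \<theta>1 \<theta>inf = {((M0, M1), (N0, N1)).
     (M0, M1) \<in> monodromy_pairs \<theta>0 \<theta>1 \<theta>inf \<and>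
     (N0, N1) \<in> monodromy_pairs \<theta>0 \<theta>1 \<theta>inf \<and>
     (\<exists>c. c \<noteq> 0 \<and>
       N0 = sigma3_pow c 1 ** M0 ** sigma3_pow c (- 1) \<and>
       N1 = sigma3_pow c 1 ** M1 ** sigma3_pow c (- 1))}"

definition monodromy_manifold ::
    "complex \<Rightarrow> complex \<Rightarrow> complex \<Rightarrow> (mat2 \<times> mat2) set set" where
  "monodromy_manifold \<theta>0 \<theta>1 \<theta>inf =
     monodromy_pairs \<theta>0 \<theta>1 \<theta>inf // monodromy_rel \<theta>0 \<theta>1 \<theta>inf"

definition character_variety ::
    "complex \<Rightarrow> complex \<Rightarrow> complex \<Rightarrow> (complex \<times> complex \<times> complex) set" where
  "character_variety \<theta>0 \<theta>1 \<theta>inf = {(x0, x1, x2).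
     let e = e_inf \<theta>inf; T0 = tr_of \<theta>0; T1 = tr_of \<theta>1;
         \<mu>0 = T0 + e * T1; \<mu>1 = T1 + e * T0;
         \<kappa> = exp (- (2 * of_real pi * \<i> * \<theta>inf)) + e * T0 * T1 + 1
     in x0 * x1 * x2 + x0^2 + x1^2 - \<mu>0 * x0 - \<mu>1 * x1 - e * x2 + \<kappa> = 0}"

lemma sigma3_conj_entries:
  fixes M :: mat2
  assumes "c \<noteq> 0"
  shows "sigma3_pow c 1 ** M ** sigma3_pow c (- 1) =
    vector [vector [M$1$1, c^2 * M$1$2], vector [M$2$1 / c^2, M$2$2]]"
  using assms
  by (simp add: sigma3_pow_def vec_eq_iff forall_2 matrix_matrix_mult_def sum_2
      power_int_minus field_simps power2_eq_square)

lemma equiv_monodromy_rel: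
  "equiv (monodromy_pairs \<theta>0 \<theta>1 \<theta>inf) (monodromy_rel \<theta>0 \<theta>1 \<theta>inf)"
proof (rule equivI)
  show "monodromy_rel \<theta>0 \<theta>1 \<theta>inf \<subseteq>
      monodromy_pairs \<theta>0 \<theta>1 \<theta>inf \<times> monodromy_pairs \<theta>0 \<theta>1 \<theta>inf"
    by (auto simp: monodromy_rel_def)
  show "refl_on (monodromy_pairs \<theta>0 \<theta>1 \<theta>inf) (monodromy_rel \<theta>0 \<theta>1 \<theta>inf)"
    by (auto simp: refl_on_def monodromy_rel_def sigma3_conj_entries vec_eq_iff forall_2
        intro!: exI[of _ 1])
  show "sym (monodromy_rel \<theta>0 \<theta>1 \<theta>inf)"
  proof (rule symI, clarsimp simp: monodromy_rel_def)
    fix c :: complex and a b :: mat2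
    assume c: "c \<noteq> 0"
    show "\<exists>d. d \<noteq> 0 \<and>
        a = sigma3_pow d 1 ** (sigma3_pow c 1 ** a ** sigma3_pow c (- 1)) ** sigma3_pow d (- 1) \<and>
        b = sigma3_pow d 1 ** (sigma3_pow c 1 ** b ** sigma3_pow c (- 1)) ** sigma3_pow d (- 1)"
      using c by (intro exI[of _ "inverse c"])
        (simp add: sigma3_conj_entries vec_eq_iff forall_2 field_simps)
  qed
  show "trans (monodromy_rel \<theta>0 \<theta>1 \<theta>inf)"
  proof (rule transI, clarsimp simp: monodromy_rel_def)
    fix c d :: complex and a b :: mat2
    assume cd: "c \<noteq> 0" "d \<noteq> 0"
    show "\<exists>e. e \<noteq> 0 \<and>
        sigma3_pow d 1 ** (sigma3_pow c 1 ** a ** sigma3_pow c (- 1)) ** sigma3_pow d (- 1) =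
          sigma3_pow e 1 ** a ** sigma3_pow e (- 1) \<and>
        sigma3_pow d 1 ** (sigma3_pow c 1 ** b ** sigma3_pow c (- 1)) ** sigma3_pow d (- 1) =
          sigma3_pow e 1 ** b ** sigma3_pow e (- 1)"
      using cd by (intro exI[of _ "d * c"])
        (simp add: sigma3_conj_entries vec_eq_iff forall_2 field_simps)
  qed
qed

end

theory Submission
  imports Defs
begin

text \<open>
  Put \<open>P = M1 ** M0\<close>. Two observations carry the proof.

  First, the normalisation \<open>M0$1$1 * M1$1$1 + M0$2$1 * M1$1$2 = e\<close> says nothing but
  \<open>P$1$1 = e\<close>. Since \<open>N1 ** N0 = P ** (M1 ** M0) ** matrix_inv P = P\<close>, conjugation of both
  matrices by \<open>P\<close> keeps this entry, and of course the two traces and determinants, so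
  \<open>(N0, N1)\<close> is again a monodromy pair. Hence \<open>y2 = x2\<close>, and the new point lies on the character
  variety because every monodromy pair gives a point there
  (\<open>monodromy_pair_in_character_variety\<close>).

  Second, by the Cayley-Hamilton theorem the conjugate of \<open>A\<close> by a matrix \<open>P\<close> of determinant 1
  is \<open>tr P \<cdot> PA - tr(PA) \<cdot> P + adj A\<close> (\<open>conjugate_eq_linear\<close>). For \<open>A = M0\<close> and \<open>A = M1\<close> the
  product \<open>PA\<close> is \<open>M1 M0\<^sup>2\<close> or \<open>M1 M0 M1\<close>, which Cayley-Hamilton reduces again to a
  linear combination of \<open>P\<close>, \<open>M0\<close>, \<open>M1\<close> and the identity. All upper left entries and traces that
  occur in these formulas are known in terms of \<open>x0\<close>, \<open>x1\<close>, \<open>x2\<close>, \<open>e\<close> and the traces.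
\<close>

section \<open>Cayley-Hamilton identities for 2 by 2 matrices\<close>

text \<open>The classical adjugate, in the form in which Cayley-Hamilton produces it. Scalar multiples
  of matrices are written below as products with the scalar matrix \<open>mat t\<close>.\<close>

definition adj2 :: "'a::comm_ring_1 ^ 2 ^ 2 \<Rightarrow> 'a ^ 2 ^ 2" where
  "adj2 A = mat (trace A) - A"

lemmas entrywise2 = vec_eq_iff forall_2 matrix_matrix_mult_def sum_2 trace_def mat_def det_2

lemma mat_mult_nth: "(mat t ** A) $ i $ j = t * A $ i $ j"
  for A :: "'a::comm_ring_1 ^ 'n ^ 'n"
proof -
  have "(mat t ** A) $ i $ j = (\<Sum>k\<in>UNIV. if k = i then t * A $ i $ j else 0)"
    unfolding matrix_matrix_mult_def mat_def vec_lambda_beta by (rule sum.cong) auto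
  then show ?thesis by simp
qed

lemma trace_mat_mult: "trace (mat t ** A) = t * trace A"
  for A :: "'a::comm_ring_1 ^ 'n ^ 'n"
  by (simp add: trace_def mat_mult_nth sum_distrib_left)

lemma
  fixes A :: "'a::comm_ring_1 ^ 2 ^ 2"
  shows mult_adj2: "A ** adj2 A = mat (det A)"
    and adj2_mult: "adj2 A ** A = mat (det A)"
  by (simp_all add: adj2_def entrywise2 algebra_simps)

lemma adj2_nth_1_1: "adj2 A $ 1 $ 1 = trace A - A $ 1 $ 1"
  by (simp add: adj2_def mat_def)

lemma trace_adj2: "trace (adj2 A) = trace A"
  by (simp add: adj2_def trace_def mat_def sum_2)

lemma matrix_inv_unimodular:
  fixes A :: "'a::comm_ring_1 ^ 2 ^ 2"
  assumes "det A = 1"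
  shows "A ** matrix_inv A = mat 1" and "matrix_inv A ** A = mat 1"
    and "matrix_inv A = adj2 A"
proof -
  have adj: "A ** adj2 A = mat 1" "adj2 A ** A = mat 1"
    using assms by (simp_all add: mult_adj2 adj2_mult)
  then have inv: "invertible A" unfolding invertible_def by blast
  then show "A ** matrix_inv A = mat 1"
    unfolding invertible_def matrix_inv_def by (rule someI2_ex) simp
  then have "adj2 A ** (A ** matrix_inv A) = adj2 A" by simp
  then show eq: "matrix_inv A = adj2 A"
    by (simp add: matrix_mul_assoc adj)
  then show "matrix_inv A ** A = mat 1" by (simp add: adj)
qed

text \<open>For invertible \<open>A\<close> this is the Cayley-Hamilton identity of \<open>B ** A\<close>, multiplied on the right
  by the inverse of \<open>A\<close>. The adjugate clears the denominators.\<close>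

lemma sandwich_mult:
  fixes A B :: "'a::comm_ring_1 ^ 2 ^ 2"
  shows "B ** A ** B = mat (trace (B ** A)) ** B - mat (det B) ** adj2 A"
  by (simp add: adj2_def entrywise2 algebra_simps)

text \<open>The case \<open>A = mat 1\<close> of the sandwich identity is the Cayley-Hamilton theorem itself.\<close>

lemma square_unimodular:
  fixes A :: "'a::comm_ring_1 ^ 2 ^ 2"
  assumes "det A = 1"
  shows "A ** A = mat (trace A) ** A - mat 1"
proof -
  have "adj2 (mat 1 :: 'a ^ 2 ^ 2) = mat 1"
    by (simp add: adj2_def entrywise2)
  then show ?thesis using sandwich_mult[of A "mat 1"] assms by simp
qed

text \<open>Cayley-Hamilton replaces the inverse of \<open>P\<close> by \<open>tr P - P\<close>, and the sandwich identity then
  removes the product \<open>P A P\<close>.\<close>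

lemma conjugate_eq_linear:
  fixes A P :: "'a::comm_ring_1 ^ 2 ^ 2"
  assumes "det P = 1"
  shows "P ** A ** matrix_inv P =
    mat (trace P) ** (P ** A) - mat (trace (P ** A)) ** P + adj2 A"
proof -
  have "P ** A ** adj2 P = mat (trace P) ** (P ** A) - P ** A ** P"
    by (simp add: adj2_def entrywise2 algebra_simps)
  then show ?thesis
    using assms by (simp add: matrix_inv_unimodular sandwich_mult[of P A])
qed

lemma conjugate_nth_1_1:
  fixes A P :: "'a::comm_ring_1 ^ 2 ^ 2"
  assumes "det P = 1"
  shows "(P ** A ** matrix_inv P) $ 1 $ 1 =
    trace P * (P ** A) $ 1 $ 1 - trace (P ** A) * P $ 1 $ 1 + trace A - A $ 1 $ 1"
  by (simp add: conjugate_eq_linear[OF assms] mat_mult_nth adj2_nth_1_1)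

section \<open>Monodromy pairs and the character variety\<close>

lemma monodromy_pairs_iff:
  "(M0, M1) \<in> monodromy_pairs \<theta>0 \<theta>1 \<theta>inf \<longleftrightarrow>
     det M0 = 1 \<and> det M1 = 1 \<and> (M1 ** M0) $ 1 $ 1 = e_inf \<theta>inf \<and>
     trace M0 = tr_of \<theta>0 \<and> trace M1 = tr_of \<theta>1"
  by (simp add: monodromy_pairs_def SL2_def matrix_matrix_mult_def sum_2 algebra_simps)

lemma monodromy_manifold_memD:
  assumes "C \<in> monodromy_manifold \<theta>0 \<theta>1 \<theta>inf" and "p \<in> C"
  shows "p \<in> monodromy_pairs \<theta>0 \<theta>1 \<theta>inf"
  using in_quotient_imp_subset[OF equiv_monodromy_rel] assms
  unfolding monodromy_manifold_def by blast

text \<open>The off-diagonal entries enter \<open>e\<close> and \<open>x2\<close> only through the products \<open>M1$1$2 * M0$2$1\<close> and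
  \<open>M1$2$1 * M0$1$2\<close>. The product of these two is also the product of \<open>M0$1$2 * M0$2$1\<close> and
  \<open>M1$1$2 * M1$2$1\<close>, which the two determinants determine from the diagonals. Equating the two
  expressions gives the cubic relation.\<close>

lemma monodromy_pair_in_character_variety:
  assumes "(M0, M1) \<in> monodromy_pairs \<theta>0 \<theta>1 \<theta>inf"
  shows "(M0$1$1, M1$1$1, trace (M1 ** M0)) \<in> character_variety \<theta>0 \<theta>1 \<theta>inf"
proof -
  let ?x0 = "M0$1$1" and ?x1 = "M1$1$1" and ?x2 = "trace (M1 ** M0)"
  let ?e = "e_inf \<theta>inf" and ?T0 = "tr_of \<theta>0" and ?T1 = "tr_of \<theta>1"
  have det: "M0$1$2 * M0$2$1 = ?x0 * M0$2$2 - 1" "M1$1$2 * M1$2$1 = ?x1 * M1$2$2 - 1"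
    and e: "M1$1$2 * M0$2$1 = ?e - ?x1 * ?x0"
    and diag: "M0$2$2 = ?T0 - ?x0" "M1$2$2 = ?T1 - ?x1"
    using assms
    by (auto simp: monodromy_pairs_iff det_2 trace_def matrix_matrix_mult_def sum_2 algebra_simps)
  have x2: "M1$2$1 * M0$1$2 = ?x2 - ?e - M1$2$2 * M0$2$2"
    using e by (simp add: trace_def matrix_matrix_mult_def sum_2)
  have "(M1$1$2 * M0$2$1) * (M1$2$1 * M0$1$2) = (M0$1$2 * M0$2$1) * (M1$1$2 * M1$2$1)"
    by simp
  then have "(?e - ?x1 * ?x0) * (?x2 - ?e - (?T1 - ?x1) * (?T0 - ?x0)) =
      (?x0 * (?T0 - ?x0) - 1) * (?x1 * (?T1 - ?x1) - 1)"
    unfolding det e x2 diag .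
  moreover have "exp (- (2 * of_real pi * \<i> * \<theta>inf)) = ?e^2"
    unfolding e_inf_def exp_double[symmetric] by (simp add: algebra_simps)
  ultimately show ?thesis
    unfolding character_variety_def Let_def mem_Collect_eq prod.case by algebra
qed

text \<open>Conjugation by \<open>M1 ** M0\<close> fixes the product \<open>M1 ** M0\<close>. Its upper left entry is the only
  part of the definition of a monodromy pair that is not invariant under simultaneous conjugation
  by an arbitrary invertible matrix.\<close>

lemma conjugate_by_product:
  assumes "(M0, M1) \<in> monodromy_pairs \<theta>0 \<theta>1 \<theta>inf"
    and "P = M1 ** M0"
    and "N0 = P ** M0 ** matrix_inv P" and "N1 = P ** M1 ** matrix_inv P"
  shows "N1 ** N0 = P" and "(N0, N1) \<in> monodromy_pairs \<theta>0 \<theta>1 \<theta>inf"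
proof -
  note pair = assms(1)[unfolded monodromy_pairs_iff]
  have "det P = 1" using pair assms(2) by (simp add: det_mul)
  note inv = matrix_inv_unimodular(1,2)[OF this]
  have "N1 ** N0 = P ** M1 ** (matrix_inv P ** P) ** M0 ** matrix_inv P"
    unfolding assms(3,4) by (simp only: matrix_mul_assoc)
  also have "\<dots> = P ** (M1 ** M0) ** matrix_inv P"
    by (simp add: inv matrix_mul_assoc)
  also have "\<dots> = P ** (P ** matrix_inv P)"
    unfolding assms(2) by (simp only: matrix_mul_assoc)
  finally show prod: "N1 ** N0 = P" by (simp add: inv)
  have "trace (P ** A ** matrix_inv P) = trace A" for A
    by (subst trace_mul_sym) (simp add: matrix_mul_assoc inv)
  moreover have "det (P ** A ** matrix_inv P) = det A" for A
    using arg_cong[OF inv(1), of det] by (simp add: det_mul)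
  ultimately show "(N0, N1) \<in> monodromy_pairs \<theta>0 \<theta>1 \<theta>inf"
    using pair prod assms unfolding monodromy_pairs_iff by simp
qed

theorem corollary2p19:
  fixes \<theta>0 \<theta>1 \<theta>inf :: complex
    and C :: "(mat2 \<times> mat2) set"
    and M0 M1 P N0 N1 :: mat2
    and x0 x1 x2 y0 y1 y2 :: complex
  assumes "C \<in> monodromy_manifold \<theta>0 \<theta>1 \<theta>inf"
    and "(M0, M1) \<in> C"
    and "x0 = M0$1$1" and "x1 = M1$1$1" and "x2 = trace (M1 ** M0)"
    and "P = M1 ** M0"
    and "N0 = P ** M0 ** matrix_inv P" and "N1 = P ** M1 ** matrix_inv P"
    and "y0 = N0$1$1" and "y1 = N1$1$1" and "y2 = trace (N1 ** N0)"
  shows "(y0, y1, y2) \<in> character_variety \<theta>0 \<theta>1 \<theta>inf \<and>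
    y0 = - x1 * x2 - x0 + trace M0 + e_inf \<theta>inf * trace M1 \<and>
    y1 = x1 * x2^2 + x0 * x2 - x1 - (trace M0 + e_inf \<theta>inf * trace M1) * x2
           + trace M1 + e_inf \<theta>inf * trace M0 \<and>
    y2 = x2"
proof -
  let ?e = "e_inf \<theta>inf"
  have mem: "(M0, M1) \<in> monodromy_pairs \<theta>0 \<theta>1 \<theta>inf"
    using assms(1,2) by (rule monodromy_manifold_memD)
  then have det: "det M0 = 1" "det M1 = 1" and e: "P $ 1 $ 1 = ?e"
    using assms(6) by (simp_all add: monodromy_pairs_iff)
  have detP: "det P = 1" and trP: "trace P = x2"
    using det assms(5,6) by (simp_all add: det_mul)

  note conj = conjugate_by_product[OF mem assms(6-8)]
  have y2: "y2 = x2" using conj(1) trP assms(11) by simp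
  have "(y0, y1, y2) \<in> character_variety \<theta>0 \<theta>1 \<theta>inf"
    using monodromy_pair_in_character_variety[OF conj(2)] assms(9-11) by simp

  moreover have "y0 = - x1 * x2 - x0 + trace M0 + ?e * trace M1"
  proof -
    have "P ** M0 = M1 ** (mat (trace M0) ** M0 - mat 1)"
      using assms(6) square_unimodular[OF det(1)] by (simp add: matrix_mul_assoc[symmetric])
    also have "\<dots> = mat (trace M0) ** P - M1"
      unfolding assms(6) by (simp add: entrywise2 algebra_simps)
    finally have entry: "(P ** M0) $ 1 $ 1 = trace M0 * ?e - x1"
      and tr: "trace (P ** M0) = trace M0 * x2 - trace M1"
      using e trP assms(4) by (simp_all add: mat_mult_nth trace_sub trace_mat_mult)
    have "y0 = x2 * (P ** M0) $ 1 $ 1 - trace (P ** M0) * ?e + trace M0 - x0"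
      using conjugate_nth_1_1[OF detP, of M0] e trP assms(3,7,9) by simp
    then show ?thesis
      unfolding entry tr by (simp add: algebra_simps)
  qed

  moreover have "y1 = x1 * x2^2 + x0 * x2 - x1 - (trace M0 + ?e * trace M1) * x2
      + trace M1 + ?e * trace M0"
  proof -
    have "P ** M1 = mat x2 ** M1 - adj2 M0"
      using sandwich_mult[of M1 M0] det assms(5,6) by simp
    then have entry: "(P ** M1) $ 1 $ 1 = x2 * x1 - trace M0 + x0"
      and tr: "trace (P ** M1) = x2 * trace M1 - trace M0"
      using assms(3,4) by (simp_all add: mat_mult_nth adj2_nth_1_1 trace_sub trace_mat_mult trace_adj2)
    have "y1 = x2 * (P ** M1) $ 1 $ 1 - trace (P ** M1) * ?e + trace M1 - x1"
      using conjugate_nth_1_1[OF detP, of M1] e trP assms(4,8,10) by simp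
    then show ?thesis
      unfolding entry tr by (simp add: algebra_simps power2_eq_square)
  qed

  ultimately show ?thesis using y2 by blast
qed

end
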